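(* Let $Z, Z_1, Z_2, \ldots$ be independent and identically distributed real random variables with $\mathrm{E}[Z] = 0$ and $\mathrm{E}[|Z|] = 1$. For $n \ge 1$ let $U_n = Z_1 + \cdots + Z_n$ and let $S_n = U_n/n$. Let $D$ be a deterministic random variable with $\Pr[D=0]=1$. Then $\lim_{n\to\infty} F_{S_n}(t) = F_D(t)$ for all real $t$ at which $F_D$ is continuous (that is, for all $t \ne 0$).
   Context: For a real random variable $X$, $F_X(x) = \Pr[X \le x]$ denotes its distribution function. *)

theory Defs
  imports "HOL-Probability.Probability"
begin

end

theory Submission
  imports Defs
begin

text \<open>
  For \<open>\<phi>\<close> the characteristic function of \<open>Z\<close>, the mean of \<open>n\<close> independent copies has characteristic
  function \<open>\<phi> (t / n) ^ n\<close>. As \<open>Z\<close> is integrable with mean zero, \<open>\<phi> s = 1 + o(s)\<close> for \<open>s \<rightarrow> 0\<close>, so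
  \<open>\<bar>\<phi> (t / n) ^ n - 1\<bar> \<le> n \<bar>\<phi> (t / n) - 1\<bar> \<rightarrow> 0\<close>. By Levy's continuity theorem the means converge
  weakly to the point mass at zero, whose distribution function is continuous exactly off zero.
\<close>

text \<open>First-order Taylor estimate; the linear term vanishes with the mean. Inside the minimum,
  \<open>4 * \<bar>x\<bar>\<close> keeps the expectation finite given only a first moment, while
  \<open>\<bar>t\<bar> * x\<^sup>2\<close> forces it to 0 as \<open>t\<close> does, so the bound is
  o(t).\<close>

lemma (in real_distribution) char_approx_zero_mean:
  assumes int: "integrable M (\<lambda>x. x)" and mean: "expectation (\<lambda>x. x) = 0"
  shows "cmod (char M t - 1) \<le> \<bar>t\<bar> / 2 * expectation (\<lambda>x. min (4 * \<bar>x\<bar>) (\<bar>t\<bar> * x\<^sup>2))"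
proof -
  have "integrable M (\<lambda>x. x ^ k)" if "k \<le> 1" for k
    using that int by (cases "k = 0") (auto simp: le_Suc_eq)
  from char_approx2[of 1 t, OF this] mean show ?thesis
    by (simp add: numeral_2_eq_2[symmetric] prob_space[simplified])
qed

theorem (in prob_space) weak_law_of_large_numbers_zero_mean:
  fixes X :: "nat \<Rightarrow> 'a \<Rightarrow> real" and \<mu> :: "real measure"
  assumes X_indep: "indep_vars (\<lambda>i. borel) X {1..}"
    and X_distrib: "\<And>i. i \<ge> 1 \<Longrightarrow> distr M borel (X i) = \<mu>"
    and \<mu>_integrable: "integrable \<mu> (\<lambda>x. x)"
    and \<mu>_mean: "(LINT x|\<mu>. x) = 0"
  shows "weak_conv_m (\<lambda>n. distr M borel (\<lambda>x. (\<Sum>i=1..n. X i x) / real n)) (return borel 0)"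
proof -
  have X_rv: "random_variable borel (X i)" if "i \<ge> 1" for i
    using X_indep that unfolding indep_vars_def2 by simp
  have mean_rv: "random_variable borel (\<lambda>x. (\<Sum>i=1..n. X i x) / real n)" for n
    by (intro borel_measurable_divide borel_measurable_sum X_rv) auto
  interpret \<mu>: real_distribution \<mu>
    by (subst X_distrib [symmetric, of 1]) (auto intro!: X_rv)

  have char_mean: "char (distr M borel (\<lambda>x. (\<Sum>i=1..n. X i x) / real n)) t = char \<mu> (t / n) ^ n" for n t
  proof -
    have "char (distr M borel (\<lambda>x. (\<Sum>i=1..n. X i x) / real n)) t
        = char (distr M borel (\<lambda>x. \<Sum>i=1..n. X i x / real n)) t"
      \<comment> \<open>Dividing termwise turns the mean into a sum of independent variables, so its
        characteristic function factors.\<close>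
      by (simp add: sum_divide_distrib)
    also have "\<dots> = (\<Prod>i=1..n. char (distr M borel (\<lambda>x. X i x / real n)) t)"
      by (rule char_distr_sum, rule indep_vars_compose2[where X = X], rule indep_vars_subset[OF X_indep])
        auto
    also have "\<dots> = (\<Prod>i=1..n. char \<mu> (t / n))"
    proof (intro prod.cong refl)
      fix i assume "i \<in> {1..n}"
      then have "\<mu> = distr M borel (X i)" and [measurable]: "random_variable borel (X i)"
        by (simp_all add: X_distrib X_rv)
      \<comment> \<open>The scaling by \<open>1 / n\<close> moves from the variable to the
        argument.\<close>
      then show "char (distr M borel (\<lambda>x. X i x / real n)) t = char \<mu> (t / n)"
        unfolding char_def by (simp add: integral_distr)
    qed
    finally show ?thesis by simp
  qed

  have bound: "cmod (char \<mu> (t / n) ^ n - 1)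
      \<le> \<bar>t\<bar> / 2 * \<mu>.expectation (\<lambda>x. min (4 * \<bar>x\<bar>) (\<bar>t / n\<bar> * x\<^sup>2))" if "n > 0" for n :: nat and t
  proof -
    \<comment> \<open>Writing 1 as \<open>1 ^ n\<close> gives a difference of powers of two points
      of the closed unit disc.\<close>
    have "cmod (char \<mu> (t / n) ^ n - 1 ^ n) \<le> n * cmod (char \<mu> (t / n) - 1)"
      by (intro norm_power_diff \<mu>.cmod_char_le_1) simp
    also have "\<dots> \<le> n * (\<bar>t / n\<bar> / 2 * \<mu>.expectation (\<lambda>x. min (4 * \<bar>x\<bar>) (\<bar>t / n\<bar> * x\<^sup>2)))"
      by (intro mult_left_mono \<mu>.char_approx_zero_mean \<mu>_integrable \<mu>_mean) simp_all
    \<comment> \<open>The outer \<open>n\<close> cancels; the \<open>t / n\<close> inside the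
      minimum survives and drives the limit.\<close>
    also have "\<dots> = \<bar>t\<bar> / 2 * \<mu>.expectation (\<lambda>x. min (4 * \<bar>x\<bar>) (\<bar>t / n\<bar> * x\<^sup>2))"
      using that by simp
    finally show ?thesis by simp
  qed

  show ?thesis
  proof (rule levy_continuity)
    fix t :: real
    have "(\<lambda>n. min (4 * \<bar>x\<bar>) (\<bar>t / real n\<bar> * x\<^sup>2)) \<longlonglongrightarrow> 0" for x
    proof -
      have "(\<lambda>n. \<bar>t / real n\<bar> * x\<^sup>2) \<longlonglongrightarrow> 0"
        by (intro tendsto_mult_left_zero tendsto_rabs_zero lim_const_over_n)
      from tendsto_min[OF tendsto_const[of "4 * \<bar>x\<bar>"] this] show ?thesis by simp
    qed
    then have "(\<lambda>n. \<mu>.expectation (\<lambda>x. min (4 * \<bar>x\<bar>) (\<bar>t / real n\<bar> * x\<^sup>2))) \<longlonglongrightarrow> \<mu>.expectation (\<lambda>x. 0)"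
      \<comment> \<open>The first branch of the minimum is the dominating function.\<close>
      by (intro integral_dominated_convergence[where w = "\<lambda>x. 4 * \<bar>x\<bar>"]) (auto simp: \<mu>_integrable)
    then have "(\<lambda>n. \<bar>t\<bar> / 2 * \<mu>.expectation (\<lambda>x. min (4 * \<bar>x\<bar>) (\<bar>t / real n\<bar> * x\<^sup>2))) \<longlonglongrightarrow> 0"
      by (simp only: integral_zero tendsto_mult_right_zero)
    then have "(\<lambda>n. char \<mu> (t / real n) ^ n - 1) \<longlonglongrightarrow> 0"
      by (rule Lim_null_comparison[rotated])
        (rule eventually_mono[OF eventually_gt_at_top[of 0] bound])
    moreover have "char (return borel 0) t = 1"
      by (simp add: char_def integral_return)
    ultimately show "(\<lambda>n. char (distr M borel (\<lambda>x. (\<Sum>i=1..n. X i x) / real n)) t) \<longlonglongrightarrow> char (return borel 0) t"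
      unfolding char_mean by (simp add: LIM_zero_iff)
  next
    show "real_distribution (return borel 0)"
      by (auto simp: real_distribution_def real_distribution_axioms_def intro!: prob_space_return)
  qed (rule real_distribution_distr[OF mean_rv])
qed

text \<open>A law ignores null sets, so \<open>D\<close> may be replaced by the constant.\<close>

lemma (in prob_space) distr_AE_const:
  fixes c :: real
  assumes [measurable]: "D \<in> borel_measurable M" and "prob {\<omega> \<in> space M. D \<omega> = c} = 1"
  shows "distr M borel D = return borel c"
proof -
  have "AE \<omega> in M. D \<omega> = c"
    using assms(2) by (subst prob_Collect_eq_1[symmetric]) auto
  then have "distr M borel D = distr M borel (\<lambda>_. c)"
    by (intro distr_cong_AE) auto
  then show ?thesis
    by simp
qed

theorem theorem2:
  fixes M :: "'a measure" and N :: "'b measure"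
    and Z :: "'a \<Rightarrow> real" and Zs :: "nat \<Rightarrow> 'a \<Rightarrow> real" and D :: "'b \<Rightarrow> real"
  assumes "prob_space M"
    and "prob_space.indep_vars M (\<lambda>_. borel) (\<lambda>i. if i = 0 then Z else Zs i) (UNIV :: nat set)"
    and "\<And>i. i \<ge> 1 \<Longrightarrow> distr M borel (Zs i) = distr M borel Z"
    and "(LINT \<omega>|M. Z \<omega>) = 0"
    and "(LINT \<omega>|M. \<bar>Z \<omega>\<bar>) = 1"
    and "prob_space N"
    and "D \<in> borel_measurable N"
    and "measure N {\<omega> \<in> space N. D \<omega> = 0} = 1"
  shows "(\<forall>t. isCont (cdf (distr N borel D)) t \<longrightarrow>
           (\<lambda>n. cdf (distr M borel (\<lambda>\<omega>. (\<Sum>i=1..n. Zs i \<omega>) / real n)) t)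
             \<longlonglongrightarrow> cdf (distr N borel D) t)
       \<and> (\<forall>t. isCont (cdf (distr N borel D)) t \<longleftrightarrow> t \<noteq> 0)"
proof -
  interpret prob_space M by fact
  interpret N: prob_space N by fact
  have D: "distr N borel D = return borel 0"
    using assms(7,8) by (rule N.distr_AE_const)
  interpret D: real_distribution "return borel (0 :: real)"
    by (auto simp: real_distribution_def real_distribution_axioms_def intro!: prob_space_return)

  have "random_variable borel (if (0::nat) = 0 then Z else Zs 0)"
    using assms(2) unfolding indep_vars_def2 by blast
  then have Z_rv [measurable]: "random_variable borel Z"
    by simp
  \<comment> \<open>A non-integrable function has integral 0 by convention, so the value 1 certifies
    integrability.\<close>
  have "integrable M (\<lambda>\<omega>. \<bar>Z \<omega>\<bar>)"
    using assms(5) not_integrable_integral_eq by fastforce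
  then have "integrable M Z"
    by (subst (asm) integrable_abs_iff) auto
  then have int: "integrable (distr M borel Z) (\<lambda>x. x)" and mean: "(LINT x|distr M borel Z. x) = 0"
    using assms(4) by (simp_all add: integrable_distr_eq integral_distr)
  \<comment> \<open>Index 0 carries \<open>Z\<close>; away from it the family is
    \<open>Zs\<close>.\<close>
  have "indep_vars (\<lambda>_. borel) (\<lambda>i. if i = 0 then Z else Zs i) {1..}"
    using assms(2) by (rule indep_vars_subset) simp
  also have "?this \<longleftrightarrow> indep_vars (\<lambda>_. borel) Zs {1..}"
    by (intro indep_vars_cong) auto
  finally have "weak_conv_m (\<lambda>n. distr M borel (\<lambda>\<omega>. (\<Sum>i=1..n. Zs i \<omega>) / real n)) (return borel 0)"
    using assms(3) int mean by (rule weak_law_of_large_numbers_zero_mean)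
  \<comment> \<open>A distribution function is continuous exactly where its law has no atom, and the
    only atom here is 0.\<close>
  then show ?thesis
    by (auto simp: D weak_conv_m_def weak_conv_def D.isCont_cdf measure_return
      indicator_def)
qed

end
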